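(* Let $d\ge 1$ and let $X=\{x_1,\dots,x_N\}$ be a finite nonempty subset of the unit sphere $S^d\subset\mathbb{R}^{d+1}$ satisfying \[ \frac{1}{|X|^2}\sum_{x_i,x_j\in X}(x_i,x_j)^2=\frac{1}{d+1},\qquad \frac{1}{|X|^2}\sum_{x_i,x_j\in X}(x_i,x_j)^4=\frac{3}{(d+3)(d+1)}, \] where both sums run over all ordered pairs $(i,j)$, $1\le i,j\le N$ (including $i=j$). Then the multiset $\widetilde{G_X}:=\{G_{x_1},\dots,G_{x_N}\}\cup\{-G_{x_1},\dots,-G_{x_N}\}$ (of $2N$ points, counted with multiplicity) is a spherical $3$-design in the unit sphere $S^{D-1}$ of $\mathrm{Harm}_2(S^d)\cong\mathbb{R}^D$, where $D=\dim \mathrm{Harm}_2(S^d)=d(d+3)/2$.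
   Context: $(\cdot,\cdot)$ is the standard inner product on $\mathbb{R}^{d+1}$. $\mathrm{Harm}_2(S^d)$ denotes the real vector space of restrictions to $S^d$ of homogeneous polynomials $P$ of degree $2$ on $\mathbb{R}^{d+1}$ that are harmonic ($\sum_{j}\partial^2P/\partial x_j^2=0$); its dimension is $D=d(d+3)/2$. Equip it with the inner product $\langle P,Q\rangle=\int_{S^d}P(x)Q(x)\,d\sigma(x)$, $\sigma$ the normalized surface measure, and identify it with $\mathbb{R}^D$ via an orthonormal basis. For $x\in S^d$ let $K_x\in\mathrm{Harm}_2(S^d)$ be the reproducing element ($\langle K_x,Q\rangle=Q(x)$ for all $Q$), and set $G_x=K_x/\|K_x\|$; then $G_x$ is a unit vector and $\langle G_x,G_y\rangle=g_{2,d}((x,y))$ with $g_{2,d}(t)=\frac{d+1}{d}t^2-\frac1d$. A finite nonempty multiset $Y$ in a unit sphere $S^{m}\subset\mathbb{R}^{m+1}$ is a spherical $t$-design if $\frac{1}{|Y|}\sum_{y\in Y}f(y)=\int_{S^m}f\,d\sigma$ for every polynomial $f$ on $\mathbb{R}^{m+1}$ of degree at most $t$ (points counted with multiplicity, $\sigma$ normalized surface measure). *)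

theory Defs
  imports "HOL-Analysis.Analysis" "HOL-Library.Multiset"
begin

text \<open>Normalized surface measure on the unit sphere of a Euclidean space: the push-forward
  of the uniform probability measure on the unit ball under radial projection.\<close>
definition sphere_measure :: "'a::euclidean_space measure" where
  "sphere_measure = distr (uniform_measure lborel (ball 0 1)) borel (\<lambda>x. x /\<^sub>R norm x)"

definition poly_deg_le :: "nat \<Rightarrow> ('a::euclidean_space \<Rightarrow> real) set" where
  "poly_deg_le t = {f. \<exists>(A::('a \<Rightarrow> nat) set) c. finite A \<and>
      (\<forall>\<alpha>\<in>A. (\<Sum>b\<in>Basis. \<alpha> b) \<le> t) \<and>
      f = (\<lambda>x. \<Sum>\<alpha>\<in>A. c \<alpha> * (\<Prod>b\<in>Basis. (x \<bullet> b) ^ \<alpha> b))}"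

definition spherical_design :: "nat \<Rightarrow> 'a::euclidean_space multiset \<Rightarrow> bool" where
  "spherical_design t Y \<longleftrightarrow> Y \<noteq> {#} \<and> (\<forall>y\<in>#Y. norm y = 1) \<and>
     (\<forall>f\<in>poly_deg_le t. (\<Sum>y\<in>#Y. f y) / real (size Y) = integral\<^sup>L sphere_measure f)"

definition hom_quadratic :: "(real^'n \<Rightarrow> real) \<Rightarrow> bool" where
  "hom_quadratic P \<longleftrightarrow> (\<exists>c. P = (\<lambda>x. \<Sum>i\<in>UNIV. \<Sum>j\<in>UNIV. c i j * (x$i) * (x$j)))"

definition harmonic :: "(real^'n \<Rightarrow> real) \<Rightarrow> bool" where
  "harmonic P \<longleftrightarrow> (\<forall>x. (\<Sum>j\<in>UNIV. (deriv ^^ 2) (\<lambda>t. P (x + t *\<^sub>R axis j 1)) 0) = 0)"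

definition Harm2 :: "(real^'n \<Rightarrow> real) set" where
  "Harm2 = {P. hom_quadratic P \<and> harmonic P}"

definition harm_inner :: "(real^'n \<Rightarrow> real) \<Rightarrow> (real^'n \<Rightarrow> real) \<Rightarrow> real" where
  "harm_inner P Q = integral\<^sup>L sphere_measure (\<lambda>x. P x * Q x)"

definition reproducing_kernel :: "real^'n \<Rightarrow> (real^'n \<Rightarrow> real)" where
  "reproducing_kernel x = (THE K. K \<in> Harm2 \<and> (\<forall>Q\<in>Harm2. harm_inner K Q = Q x))"

definition Gfun :: "real^'n \<Rightarrow> (real^'n \<Rightarrow> real)" where
  "Gfun x = (let K = reproducing_kernel x in (\<lambda>y. K y / sqrt (harm_inner K K)))"

end

theory Submission
  imports Defs
begin

text \<open>Write \<open>n = d + 1\<close>. Rotation invariance and polarization determine the fourth moments of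
  the surface measure, and these show that the reproducing kernel of \<open>Harm\<^sub>2\<close> is
  \<open>(n + 2) / 2 * (n (x \<bullet> y)\<^sup>2 - |x|\<^sup>2 |y|\<^sup>2)\<close>. The two hypotheses on \<open>X\<close>
  then imply that the average of \<open>(G\<^sub>x \<bullet> G\<^sub>y)\<^sup>2\<close> over all pairs attains
  its minimum \<open>1 / D\<close>. Equality forces the second moment matrix of the vectors \<open>G\<^sub>x\<close> to be
  \<open>I / D\<close>, which is the design condition in degree two; the odd degrees are handled by the
  antipodal symmetry.\<close>

section \<open>Invariance of Lebesgue measure and surface measure\<close>

lemma sets_sphere_measure [simp, measurable_cong]: "sets sphere_measure = sets borel"
  by (simp add: sphere_measure_def)

lemma space_sphere_measure [simp]: "space sphere_measure = UNIV"
  by (simp add: sphere_measure_def)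

lemma nn_integral_lborel_translate:
  fixes h :: "'a::euclidean_space \<Rightarrow> ennreal"
  assumes [measurable]: "h \<in> borel_measurable borel"
  shows "(\<integral>\<^sup>+ x. h (c + x) \<partial>lborel) = (\<integral>\<^sup>+ x. h x \<partial>lborel)"
proof -
  have "(\<integral>\<^sup>+ x. h x \<partial>lborel) = (\<integral>\<^sup>+ x. h x \<partial>distr lborel borel ((+) c))"
    by (simp add: lborel_distr_plus)
  then show ?thesis
    by (simp add: nn_integral_distr)
qed

lemma nn_integral_lborel_translate_cmult:
  fixes h :: "'a::euclidean_space \<Rightarrow> ennreal"
  assumes [measurable]: "h \<in> borel_measurable borel"
  shows "(\<integral>\<^sup>+ x. a * h (c + x) \<partial>lborel) = a * (\<integral>\<^sup>+ x. h x \<partial>lborel)"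
  by (simp add: nn_integral_cmult nn_integral_lborel_translate)

lemma orthogonal_transformation_borel_measurable:
  fixes f :: "'a::euclidean_space \<Rightarrow> 'a"
  assumes "orthogonal_transformation f"
  shows "f \<in> borel_measurable borel"
  using assms by (simp add: borel_measurable_continuous_onI linear_continuous_on linear_linear
      orthogonal_transformation_linear)

lemma emeasure_unit_ball:
  "emeasure lborel (ball (0::'a::euclidean_space) 1) \<noteq> 0"
  "emeasure lborel (ball (0::'a::euclidean_space) 1) \<noteq> \<infinity>"
  using open_not_negligible[of "ball (0::'a) 1"] negligible_iff_emeasure0[of "ball (0::'a) 1"]
    emeasure_bounded_finite[of "ball (0::'a) 1"]
  by (simp_all add: less_top[symmetric])

text \<open>The usual proof that a translation-invariant measure is unique up to scaling, tested against
  the unit ball \<open>B\<close>, which \<open>f\<close> preserves: computing the double integral of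
  \<open>1\<^sub>A (f x) 1\<^sub>B (y - f x)\<close> in both orders gives
  \<open>\<lambda>(f\<^sup>-\<^sup>1 A) \<lambda>(B) = \<lambda>(A) \<lambda>(B)\<close>.\<close>
lemma emeasure_lborel_orthogonal_vimage:
  fixes f :: "'a::euclidean_space \<Rightarrow> 'a"
  assumes f: "orthogonal_transformation f" and A [measurable]: "A \<in> sets borel"
  shows "emeasure lborel (f -` A) = emeasure lborel A"
proof -
  note [measurable] = orthogonal_transformation_borel_measurable[OF f]
  have lin: "linear f"
    using f by (simp add: orthogonal_transformation_linear)
  let ?a = "indicator A :: 'a \<Rightarrow> ennreal"
  define b where "b = (indicator (ball 0 1) :: 'a \<Rightarrow> ennreal)"
  have [measurable]: "b \<in> borel_measurable borel"
    unfolding b_def by (intro borel_measurable_indicator borel_open open_ball)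
  have int_b: "(\<integral>\<^sup>+ y. b y \<partial>lborel) = emeasure lborel (ball (0::'a) 1)"
    by (simp add: b_def)
  have [measurable]: "f -` A \<in> sets borel"
    using measurable_sets[of f borel borel A] by simp
  have bf: "b (f x) = b x" "b (- x) = b x" for x
    using orthogonal_transformation_norm[OF f] by (auto simp: b_def indicator_def)
  \<comment> \<open>\<open>g\<close> is a right inverse of \<open>f\<close>. It supplies the shift
    \<open>g y\<close>, for which \<open>f (g y + x) = y + f x\<close>.\<close>
  obtain g where g: "f (g y) = y" for y
    using orthogonal_transformation_surj[OF f] by (metis surj_def)
  have "emeasure lborel (f -` A) * emeasure lborel (ball (0::'a) 1)
      = (\<integral>\<^sup>+ x. ?a (f x) * (\<integral>\<^sup>+ y. b y \<partial>lborel) \<partial>lborel)"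
  proof -
    have "?a (f x) = indicator (f -` A) x" for x
      by (auto simp: indicator_def)
    then show ?thesis
      by (simp add: nn_integral_multc int_b)
  qed
  also have "\<dots> = (\<integral>\<^sup>+ x. (\<integral>\<^sup>+ y. ?a (f x) * b (- f x + y) \<partial>lborel) \<partial>lborel)"
  proof -
    have "(\<integral>\<^sup>+ y. ?a (f x) * b (- f x + y) \<partial>lborel) = ?a (f x) * (\<integral>\<^sup>+ y. b y \<partial>lborel)" for x
      by (rule nn_integral_lborel_translate_cmult) measurable
    then show ?thesis by simp
  qed
  also have "\<dots> = (\<integral>\<^sup>+ y. (\<integral>\<^sup>+ x. ?a (f x) * b (- f x + y) \<partial>lborel) \<partial>lborel)"
    by (rule lborel_pair.Fubini'[symmetric]) measurable
  \<comment> \<open>Translating \<open>x\<close> by \<open>g y\<close> removes \<open>y\<close> from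
    the argument of \<open>b\<close>, leaving \<open>b (- f x)\<close>. This equals
    \<open>b x\<close> because the ball is symmetric and \<open>f\<close> preserves norms.\<close>
  also have "\<dots> = (\<integral>\<^sup>+ y. (\<integral>\<^sup>+ x. ?a (f (g y + x)) * b (- f (g y + x) + y) \<partial>lborel) \<partial>lborel)"
    by (subst nn_integral_lborel_translate[where h="\<lambda>x. ?a (f x) * b (- f x + y)" for y]) simp_all
  also have "\<dots> = (\<integral>\<^sup>+ y. (\<integral>\<^sup>+ x. b x * ?a (f x + y) \<partial>lborel) \<partial>lborel)"
  proof -
    have "?a (f (g y + x)) * b (- f (g y + x) + y) = b x * ?a (f x + y)" for x y
      by (simp add: linear_add[OF lin] g bf add.commute mult.commute)
    then show ?thesis by simp
  qed
  also have "\<dots> = (\<integral>\<^sup>+ x. (\<integral>\<^sup>+ y. b x * ?a (f x + y) \<partial>lborel) \<partial>lborel)"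
    by (rule lborel_pair.Fubini') measurable
  also have "\<dots> = emeasure lborel A * emeasure lborel (ball (0::'a) 1)"
    by (simp add: nn_integral_cmult nn_integral_multc int_b nn_integral_lborel_translate[where h="?a"] mult.commute)
  finally show ?thesis
    using emeasure_unit_ball[where 'a='a]
    by (simp add: ennreal_mult_cancel_left mult.commute[of _ "emeasure lborel (ball 0 1)"])
qed

section \<open>The surface measure as a rotation-invariant probability measure carried by the unit
  sphere\<close>

lemma prob_uniform_ball:
  "emeasure (uniform_measure lborel (ball (0::'a::euclidean_space) 1)) UNIV = 1"
  using emeasure_unit_ball[where 'a='a] by (simp add: ennreal_divide_self less_top[symmetric])

lemma sphere_measure_UNIV: "emeasure (sphere_measure :: 'a::euclidean_space measure) UNIV = 1"
  unfolding sphere_measure_def using prob_uniform_ball[where 'a='a]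
  by (subst emeasure_distr) auto

lemma finite_measure_sphere_measure: "finite_measure (sphere_measure :: 'a::euclidean_space measure)"
  by (rule finite_measureI) (simp add: sphere_measure_UNIV)

text \<open>Radial projection has norm one everywhere except at the origin, which is a Lebesgue null
  set.\<close>

lemma AE_sphere_measure: "AE x in (sphere_measure :: 'a::euclidean_space measure). norm x = 1"
proof -
  have "AE x in lborel. (x::'a) \<noteq> 0"
    by (rule AE_lborel_singleton)
  then have "AE x in uniform_measure lborel (ball (0::'a) 1). norm (x /\<^sub>R norm x) = 1"
    by (intro AE_uniform_measureI) (auto elim: eventually_mono)
  then show ?thesis
    unfolding sphere_measure_def by (subst AE_distr_iff) auto
qed

text \<open>A continuous function may be unbounded on the whole space, but it is bounded on the
  compact sphere, which carries all the mass.\<close>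

lemma integrable_sphere_measure:
  fixes f :: "'a::euclidean_space \<Rightarrow> real"
  assumes "continuous_on UNIV f"
  shows "integrable sphere_measure f"
proof -
  interpret finite_measure "sphere_measure :: 'a measure"
    by (rule finite_measure_sphere_measure)
  have "compact (f ` sphere 0 1)"
    by (intro compact_continuous_image continuous_on_subset[OF assms]) auto
  then obtain B where "\<forall>x\<in>sphere 0 1. norm (f x) \<le> B"
    by (auto dest!: compact_imp_bounded simp: bounded_iff)
  then have "AE x in sphere_measure. norm (f x) \<le> B"
    using AE_sphere_measure by (auto elim: eventually_mono)
  moreover have "f \<in> borel_measurable sphere_measure"
    using borel_measurable_continuous_onI[OF assms] by simp
  ultimately show ?thesis
    by (rule integrable_const_bound)
qed

lemma distr_uniform_ball_orthogonal:
  fixes f :: "'a::euclidean_space \<Rightarrow> 'a"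
  assumes f: "orthogonal_transformation f"
  shows "distr (uniform_measure lborel (ball 0 1)) borel f = uniform_measure lborel (ball 0 1)"
proof (rule measure_eqI)
  note [measurable] = orthogonal_transformation_borel_measurable[OF f]
  let ?B = "ball (0::'a) 1"
  fix A assume "A \<in> sets (distr (uniform_measure lborel ?B) borel f)"
  then have [measurable]: "A \<in> sets borel"
    by simp
  have "f -` A \<in> sets borel"
    using measurable_sets[of f borel borel A] by simp
  moreover have "?B \<inter> f -` A = f -` (?B \<inter> A)"
    using orthogonal_transformation_norm[OF f] by auto
  ultimately show "emeasure (distr (uniform_measure lborel ?B) borel f) A
      = emeasure (uniform_measure lborel ?B) A"
    using emeasure_lborel_orthogonal_vimage[OF f, of "?B \<inter> A"] by (subst emeasure_distr) auto
qed simp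

text \<open>An orthogonal map commutes with radial projection, so the invariance passes from the
  uniform measure on the ball to its push-forward.\<close>

lemma distr_sphere_measure_orthogonal:
  fixes f :: "'a::euclidean_space \<Rightarrow> 'a"
  assumes f: "orthogonal_transformation f"
  shows "distr sphere_measure borel f = sphere_measure"
proof -
  note [measurable] = orthogonal_transformation_borel_measurable[OF f]
  let ?U = "uniform_measure lborel (ball (0::'a) 1)"
  let ?r = "\<lambda>x::'a. x /\<^sub>R norm x"
  have comm: "f \<circ> ?r = ?r \<circ> f"
    using f orthogonal_transformation_norm[OF f]
    by (auto simp: linear_scale orthogonal_transformation_linear)
  have "distr sphere_measure borel f = distr ?U borel (f \<circ> ?r)"
    unfolding sphere_measure_def by (subst distr_distr) auto
  also have "\<dots> = distr (distr ?U borel f) borel ?r"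
    unfolding comm by (subst distr_distr) auto
  also have "\<dots> = sphere_measure"
    unfolding distr_uniform_ball_orthogonal[OF f] sphere_measure_def ..
  finally show ?thesis .
qed

lemma integral_sphere_measure_orthogonal:
  fixes f :: "'a::euclidean_space \<Rightarrow> 'a" and h :: "'a \<Rightarrow> real"
  assumes f: "orthogonal_transformation f" and h: "h \<in> borel_measurable borel"
  shows "integral\<^sup>L sphere_measure (\<lambda>x. h (f x)) = integral\<^sup>L sphere_measure h"
proof -
  note [measurable] = orthogonal_transformation_borel_measurable[OF f]
  have "integral\<^sup>L sphere_measure h = integral\<^sup>L (distr sphere_measure borel f) h"
    by (simp add: distr_sphere_measure_orthogonal[OF f])
  also have "\<dots> = integral\<^sup>L sphere_measure (\<lambda>x. h (f x))"
    using h by (subst integral_distr) auto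
  finally show ?thesis ..
qed

section \<open>Moments of the surface measure\<close>

lemma quartic_moment_const:
  fixes v w :: "real^'n"
  assumes "norm v = norm w"
  shows "integral\<^sup>L sphere_measure (\<lambda>y. (v \<bullet> y)^4) = integral\<^sup>L sphere_measure (\<lambda>y. (w \<bullet> y)^4)"
proof -
  obtain f where f: "orthogonal_transformation f" "f v = w"
    using orthogonal_transformation_exists[OF assms] by auto
  have "integral\<^sup>L sphere_measure (\<lambda>y. (w \<bullet> y)^4) = integral\<^sup>L sphere_measure (\<lambda>y. (f v \<bullet> f y)^4)"
    unfolding f(2) by (rule integral_sphere_measure_orthogonal[OF f(1), symmetric]) measurable
  then show ?thesis
    using f(1) by (simp add: orthogonal_transformation_def)
qed

lemma quartic_moment_scale:
  obtains c where "\<And>v::real^'n. integral\<^sup>L sphere_measure (\<lambda>y. (v \<bullet> y)^4) = c * (v \<bullet> v)^2"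
proof
  fix v :: "real^'n"
  \<comment> \<open>The index is arbitrary: by \<open>quartic_moment_const\<close> every unit vector
    gives the same moment.\<close>
  let ?e = "axis undefined 1 :: real^'n"
  have "integral\<^sup>L sphere_measure (\<lambda>y. (v \<bullet> y)^4)
      = integral\<^sup>L sphere_measure (\<lambda>y. ((norm v *\<^sub>R ?e) \<bullet> y)^4)"
    by (rule quartic_moment_const) simp
  also have "\<dots> = integral\<^sup>L sphere_measure (\<lambda>y. norm v ^ 4 * (?e \<bullet> y)^4)"
    by (simp add: power_mult_distrib)
  also have "\<dots> = integral\<^sup>L sphere_measure (\<lambda>y. (?e \<bullet> y)^4) * (v \<bullet> v)^2"
    by (simp add: dot_square_norm power_mult[symmetric] mult.commute)
  finally show "integral\<^sup>L sphere_measure (\<lambda>y. (v \<bullet> y)^4)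
      = integral\<^sup>L sphere_measure (\<lambda>y. (?e \<bullet> y)^4) * (v \<bullet> v)^2" .
qed

text \<open>The right side sums over the eight sign patterns of \<open>p\<close>, \<open>q\<close>,
  \<open>r\<close>, each weighted by the product of its signs. Only monomials odd in all three
  survive; in degree four that is \<open>p * q * r * s\<close>, with coefficient 8 * 24 =
  192.\<close>

lemma quartic_polarization:
  fixes p q r s :: real
  shows "192 * (p * q * r * s) =
      (p + q + r + s)^4 - (- p + q + r + s)^4 - (p - q + r + s)^4 - (p + q - r + s)^4
      + (- p - q + r + s)^4 + (- p + q - r + s)^4 + (p - q - r + s)^4 - (- p - q - r + s)^4"
proof -
  \<comment> \<open>Pairing opposite sign patterns reduces fourth powers to cubes. The terms
    \<open>8 * s^3 * t\<close> cancel in the total.\<close>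
  have pair: "(t + s)^4 - (- t + s)^4 = 8 * s * t^3 + 8 * s^3 * t" for t :: real
    by (simp add: eval_nat_numeral algebra_simps)
  have cubes: "(p + q + r)^3 - (- p + q + r)^3 - (p - q + r)^3 - (p + q - r)^3 = 24 * (p * q * r)"
    by (simp add: eval_nat_numeral algebra_simps)
  have "(p + q + r + s)^4 - (- p + q + r + s)^4 - (p - q + r + s)^4 - (p + q - r + s)^4
      + (- p - q + r + s)^4 + (- p + q - r + s)^4 + (p - q - r + s)^4 - (- p - q - r + s)^4
    = 8 * s * ((p + q + r)^3 - (- p + q + r)^3 - (p - q + r)^3 - (p + q - r)^3)"
    using pair[of "p + q + r"] pair[of "- p + q + r"] pair[of "p - q + r"] pair[of "p + q - r"]
    by (simp add: algebra_simps)
  then show ?thesis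
    unfolding cubes by simp
qed

text \<open>The same signed sum applied to the squared norm of a sum of four vectors, squared. Here
  \<open>n\<close> stands for the sum of the four squared norms, which no sign change affects, and
  \<open>pq\<close> etc. for the inner products. Only products of complementary pairs
  survive.\<close>

lemma quadratic_polarization:
  fixes n pq pr ps qr qs rs :: real
  shows "64 * (pq * rs + pr * qs + ps * qr) =
      (n + 2 * (pq + pr + ps + qr + qs + rs))^2 - (n + 2 * (- pq - pr - ps + qr + qs + rs))^2
      - (n + 2 * (- pq + pr + ps - qr - qs + rs))^2 - (n + 2 * (pq - pr + ps - qr + qs - rs))^2
      + (n + 2 * (pq - pr - ps - qr - qs + rs))^2 + (n + 2 * (- pq + pr - ps - qr + qs - rs))^2
      + (n + 2 * (- pq - pr + ps + qr - qs - rs))^2 - (n + 2 * (pq + pr - ps + qr - qs - rs))^2"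
  by (simp add: power2_eq_square algebra_simps)

lemma inner_self_sum4:
  fixes p q r s :: "'a::real_inner"
  shows "(p + q + r + s) \<bullet> (p + q + r + s) = (p \<bullet> p + q \<bullet> q + r \<bullet> r + s \<bullet> s)
    + 2 * (p \<bullet> q + p \<bullet> r + p \<bullet> s + q \<bullet> r + q \<bullet> s + r \<bullet> s)"
  by (simp add: inner_add_left inner_add_right inner_commute)

lemma inner_square_polarization:
  fixes u v w z :: "'a::real_inner"
  defines "f \<equiv> \<lambda>u. (u \<bullet> u)^2"
  shows "64 * ((u \<bullet> v) * (w \<bullet> z) + (u \<bullet> w) * (v \<bullet> z) + (u \<bullet> z) * (v \<bullet> w)) =
          f (u + v + w + z) - f (- u + v + w + z)
          - f (u - v + w + z) - f (u + v - w + z) + f (- u - v + w + z)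
          + f (- u + v - w + z) + f (u - v - w + z) - f (- u - v - w + z)"
  unfolding quadratic_polarization[where n="u \<bullet> u + v \<bullet> v + w \<bullet> w + z \<bullet> z"] f_def
  using inner_self_sum4[of u v w z] inner_self_sum4[of "- u" v w z]
    inner_self_sum4[of u "- v" w z] inner_self_sum4[of u v "- w" z]
    inner_self_sum4[of "- u" "- v" w z] inner_self_sum4[of "- u" v "- w" z]
    inner_self_sum4[of u "- v" "- w" z] inner_self_sum4[of "- u" "- v" "- w" z]
  by simp
text \<open>Both sides are symmetric 4-linear forms that agree on the diagonal by rotation
  invariance, so polarization identifies them everywhere. The constant is a third of the diagonal
  one because 192 = 3 * 64.\<close>

lemma quartic_moment_polarized:
  obtains c where "\<And>u v w z::real^'n. integral\<^sup>L sphere_measure (\<lambda>y. (u \<bullet> y) * (v \<bullet> y) * (w \<bullet> y) * (z \<bullet> y))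
     = c * ((u \<bullet> v) * (w \<bullet> z) + (u \<bullet> w) * (v \<bullet> z) + (u \<bullet> z) * (v \<bullet> w))"
proof -
  obtain c where c: "\<And>v::real^'n. integral\<^sup>L sphere_measure (\<lambda>y. (v \<bullet> y)^4) = c * (v \<bullet> v)^2"
    using quartic_moment_scale by blast
  have "integral\<^sup>L sphere_measure (\<lambda>y. (u \<bullet> y) * (v \<bullet> y) * (w \<bullet> y) * (z \<bullet> y))
     = c / 3 * ((u \<bullet> v) * (w \<bullet> z) + (u \<bullet> w) * (v \<bullet> z) + (u \<bullet> z) * (v \<bullet> w))"
    for u v w z :: "real^'n"
  proof -
    let ?I = "\<lambda>a::real^'n. integral\<^sup>L sphere_measure (\<lambda>y. (a \<bullet> y)^4)"
    have int: "integrable sphere_measure (\<lambda>y. (a \<bullet> y)^4)" for a :: "real^'n"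
      by (intro integrable_sphere_measure continuous_intros)
    have "192 * integral\<^sup>L sphere_measure (\<lambda>y. (u \<bullet> y) * (v \<bullet> y) * (w \<bullet> y) * (z \<bullet> y))
       = integral\<^sup>L sphere_measure (\<lambda>y. ((u + v + w + z) \<bullet> y)^4 - ((- u + v + w + z) \<bullet> y)^4
          - ((u - v + w + z) \<bullet> y)^4 - ((u + v - w + z) \<bullet> y)^4 + ((- u - v + w + z) \<bullet> y)^4
          + ((- u + v - w + z) \<bullet> y)^4 + ((u - v - w + z) \<bullet> y)^4 - ((- u - v - w + z) \<bullet> y)^4)"
      unfolding inner_add_left inner_diff_left inner_minus_left quartic_polarization[symmetric]
      by simp
    also have "\<dots> = ?I (u + v + w + z) - ?I (- u + v + w + z)
          - ?I (u - v + w + z) - ?I (u + v - w + z) + ?I (- u - v + w + z)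
          + ?I (- u + v - w + z) + ?I (u - v - w + z) - ?I (- u - v - w + z)"
      by (simp add: int)
    also have "\<dots> = 192 * (c / 3 * ((u \<bullet> v) * (w \<bullet> z) + (u \<bullet> w) * (v \<bullet> z) + (u \<bullet> z) * (v \<bullet> w)))"
      unfolding c distrib_left[symmetric] right_diff_distrib[symmetric]
        inner_square_polarization[symmetric] by simp
    finally show ?thesis by simp
  qed
  then show ?thesis by (rule that)
qed

text \<open>On the sphere the factor 1 may be written as the sum of the squared coordinates. This
  makes the second moment a contraction of the fourth; the first pairing contributes
  \<open>CARD('n)\<close> copies of \<open>u \<bullet> v\<close> and the other two contribute one
  each.\<close>

lemma quadratic_moment_unnormalized:
  fixes u v :: "real^'n"
  assumes c: "\<And>u v w z::real^'n. integral\<^sup>L sphere_measure (\<lambda>y. (u \<bullet> y) * (v \<bullet> y) * (w \<bullet> y) * (z \<bullet> y))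
     = c * ((u \<bullet> v) * (w \<bullet> z) + (u \<bullet> w) * (v \<bullet> z) + (u \<bullet> z) * (v \<bullet> w))"
  shows "integral\<^sup>L sphere_measure (\<lambda>y. (u \<bullet> y) * (v \<bullet> y)) = c * (real CARD('n) + 2) * (u \<bullet> v)"
proof -
  let ?e = "\<lambda>k. axis k 1 :: real^'n"
  have ax: "?e k \<bullet> y = y $ k" "y \<bullet> ?e k = y $ k" for y :: "real^'n" and k
    by (simp_all add: inner_axis inner_axis')
  have "AE y in sphere_measure. (u \<bullet> y) * (v \<bullet> y)
      = (\<Sum>k\<in>UNIV. (u \<bullet> y) * (v \<bullet> y) * (?e k \<bullet> y) * (?e k \<bullet> y))"
    using AE_sphere_measure
  proof eventually_elim
    case (elim y)
    then have "(\<Sum>k\<in>UNIV. y $ k * y $ k) = 1"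
      by (simp add: norm_eq_1 inner_vec_def)
    then show ?case
      by (simp add: ax mult.assoc flip: sum_distrib_left)
  qed
  then have "integral\<^sup>L sphere_measure (\<lambda>y. (u \<bullet> y) * (v \<bullet> y))
      = integral\<^sup>L sphere_measure (\<lambda>y. \<Sum>k\<in>UNIV. (u \<bullet> y) * (v \<bullet> y) * (?e k \<bullet> y) * (?e k \<bullet> y))"
    by (intro integral_cong_AE borel_measurable_integrable integrable_sphere_measure continuous_intros)
  also have "\<dots> = (\<Sum>k\<in>UNIV. integral\<^sup>L sphere_measure (\<lambda>y. (u \<bullet> y) * (v \<bullet> y) * (?e k \<bullet> y) * (?e k \<bullet> y)))"
    by (intro Bochner_Integration.integral_sum integrable_sphere_measure continuous_intros)
  also have "\<dots> = (\<Sum>k\<in>UNIV. c * (2 * (u $ k * v $ k) + u \<bullet> v))"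
    unfolding c by (simp add: ax mult.commute[of "v $ _"])
  also have "\<dots> = c * (real CARD('n) + 2) * (u \<bullet> v)"
    by (simp add: sum.distrib algebra_simps flip: sum_distrib_left)
      (simp add: inner_vec_def sum_distrib_left mult_ac)
  finally show ?thesis .
qed

lemma measure_sphere_measure_UNIV [simp]:
  "measure (sphere_measure :: 'a::euclidean_space measure) UNIV = 1"
  by (simp add: measure_def sphere_measure_UNIV)

lemma integral_sphere_measure_const:
  "integral\<^sup>L (sphere_measure :: 'a::euclidean_space measure) (\<lambda>y. a) = (a::real)"
  by simp

text \<open>Contracting once more yields the total mass, which is 1, and this fixes
  \<open>c\<close>.\<close>

lemma quartic_moment_constant:
  fixes c :: real
  assumes c: "\<And>u v w z::real^'n. integral\<^sup>L sphere_measure (\<lambda>y. (u \<bullet> y) * (v \<bullet> y) * (w \<bullet> y) * (z \<bullet> y))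
     = c * ((u \<bullet> v) * (w \<bullet> z) + (u \<bullet> w) * (v \<bullet> z) + (u \<bullet> z) * (v \<bullet> w))"
  shows "c = 1 / (real CARD('n) * (real CARD('n) + 2))"
proof -
  let ?e = "\<lambda>k. axis k 1 :: real^'n"
  have ax: "?e k \<bullet> y = y $ k" for y :: "real^'n" and k
    by (simp add: inner_axis')
  have "AE y in sphere_measure. (\<Sum>k\<in>UNIV. (?e k \<bullet> y) * (?e k \<bullet> y)) = 1"
    using AE_sphere_measure unfolding ax
    by eventually_elim (simp add: norm_eq_1 inner_vec_def)
  then have "integral\<^sup>L sphere_measure (\<lambda>y. \<Sum>k\<in>UNIV. (?e k \<bullet> y) * (?e k \<bullet> y))
      = integral\<^sup>L (sphere_measure :: (real^'n) measure) (\<lambda>y. 1)"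
    by (intro integral_cong_AE borel_measurable_integrable integrable_sphere_measure continuous_intros)
  moreover have "integral\<^sup>L sphere_measure (\<lambda>y. \<Sum>k\<in>UNIV. (?e k \<bullet> y) * (?e k \<bullet> y))
      = (\<Sum>k\<in>UNIV. integral\<^sup>L sphere_measure (\<lambda>y. (?e k \<bullet> y) * (?e k \<bullet> y)))"
    by (intro Bochner_Integration.integral_sum integrable_sphere_measure continuous_intros)
  moreover have "\<dots> = c * (real CARD('n) * (real CARD('n) + 2))"
    by (simp add: quadratic_moment_unnormalized[OF c])
  ultimately have "c * (real CARD('n) * (real CARD('n) + 2)) = 1"
    by (simp add: integral_sphere_measure_const)
  moreover have "real CARD('n) * (real CARD('n) + 2) > 0"
    by (simp add: add_pos_nonneg)
  ultimately show ?thesis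
    by (simp add: field_simps)
qed

lemma quartic_moment:
  fixes u v w z :: "real^'n"
  shows "integral\<^sup>L sphere_measure (\<lambda>y. (u \<bullet> y) * (v \<bullet> y) * (w \<bullet> y) * (z \<bullet> y))
     = ((u \<bullet> v) * (w \<bullet> z) + (u \<bullet> w) * (v \<bullet> z) + (u \<bullet> z) * (v \<bullet> w))
       / (real CARD('n) * (real CARD('n) + 2))"
proof -
  obtain c where c: "\<And>u v w z::real^'n. integral\<^sup>L sphere_measure (\<lambda>y. (u \<bullet> y) * (v \<bullet> y) * (w \<bullet> y) * (z \<bullet> y))
     = c * ((u \<bullet> v) * (w \<bullet> z) + (u \<bullet> w) * (v \<bullet> z) + (u \<bullet> z) * (v \<bullet> w))"
    using quartic_moment_polarized by blast
  show ?thesis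
    unfolding c quartic_moment_constant[OF c] by simp
qed

lemma quadratic_moment:
  fixes u v :: "real^'n"
  shows "integral\<^sup>L sphere_measure (\<lambda>y. (u \<bullet> y) * (v \<bullet> y)) = (u \<bullet> v) / real CARD('n)"
proof -
  have "real CARD('n) + 2 > 0"
    by simp
  then show ?thesis
    using quadratic_moment_unnormalized[where 'n='n and u=u and v=v
        and c="1 / (real CARD('n) * (real CARD('n) + 2))"]
    by (simp add: quartic_moment)
qed

section \<open>Harmonic quadratic forms and their reproducing kernel\<close>

lemma deriv_deriv_quadratic:
  fixes a b c :: real
  shows "(deriv ^^ 2) (\<lambda>t. a + t * b + t^2 * c) = (\<lambda>_. 2 * c)"
proof -
  have "deriv (\<lambda>t. a + t * b + t^2 * c) = (\<lambda>t. b + 2 * t * c)"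
    by (intro ext DERIV_imp_deriv) (auto intro!: derivative_eq_intros)
  moreover have "deriv (\<lambda>t. b + 2 * t * c) = (\<lambda>_. 2 * c)"
    by (intro ext DERIV_imp_deriv) (auto intro!: derivative_eq_intros)
  ultimately show ?thesis
    by (simp add: numeral_2_eq_2)
qed

text \<open>The Laplacian of a quadratic form is twice the trace of its coefficient matrix, whether
  or not that matrix is symmetric.\<close>

lemma harmonic_quadratic_form_iff:
  fixes c :: "'n::finite \<Rightarrow> 'n \<Rightarrow> real"
  shows "harmonic (\<lambda>x::real^'n. \<Sum>i\<in>UNIV. \<Sum>j\<in>UNIV. c i j * (x$i) * (x$j)) \<longleftrightarrow> (\<Sum>j\<in>UNIV. c j j) = 0"
proof -
  let ?P = "\<lambda>x::real^'n. \<Sum>i\<in>UNIV. \<Sum>j\<in>UNIV. c i j * (x$i) * (x$j)"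
  have "(deriv ^^ 2) (\<lambda>t. ?P (x + t *\<^sub>R axis l 1)) 0 = 2 * c l l" for x l
  proof -
    let ?e = "\<lambda>i. axis l 1 $ i :: real"
    have "(\<Sum>i\<in>UNIV. \<Sum>j\<in>UNIV. c i j * ?e i * ?e j) = c l l"
      by (simp add: axis_def mult_delta_left mult_delta_right)
    \<comment> \<open>Along a coordinate line the form is a quadratic polynomial in
      \<open>t\<close>; only its leading coefficient matters for the second derivative.\<close>
    moreover have "?P (x + t *\<^sub>R axis l 1) = ?P x
        + t * (\<Sum>i\<in>UNIV. \<Sum>j\<in>UNIV. c i j * (x$i * ?e j + ?e i * x$j))
        + t^2 * (\<Sum>i\<in>UNIV. \<Sum>j\<in>UNIV. c i j * ?e i * ?e j)" for t
      unfolding sum_distrib_left sum.distrib[symmetric]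
      by (intro sum.cong refl) (simp add: power2_eq_square algebra_simps)
    ultimately show ?thesis
      by (simp add: deriv_deriv_quadratic)
  qed
  then show ?thesis
    by (simp add: harmonic_def flip: sum_distrib_left)
qed

lemma Harm2E:
  assumes "P \<in> Harm2"
  obtains c where "P = (\<lambda>x. \<Sum>i\<in>UNIV. \<Sum>j\<in>UNIV. c i j * (x$i) * (x$j))" "(\<Sum>j\<in>UNIV. c j j) = 0"
  using assms harmonic_quadratic_form_iff unfolding Harm2_def hom_quadratic_def by blast

lemma Harm2I:
  assumes "P = (\<lambda>x. \<Sum>i\<in>UNIV. \<Sum>j\<in>UNIV. c i j * (x$i) * (x$j))" "(\<Sum>j\<in>UNIV. c j j) = 0"
  shows "P \<in> Harm2"
  using assms harmonic_quadratic_form_iff[of c] unfolding Harm2_def hom_quadratic_def by blast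

lemma continuous_on_Harm2:
  assumes "P \<in> Harm2"
  shows "continuous_on UNIV P"
  using assms by (elim Harm2E) (auto intro!: continuous_intros)

lemma integrable_harm_prod:
  assumes "P \<in> Harm2" "Q \<in> Harm2"
  shows "integrable sphere_measure (\<lambda>x. P x * Q x)"
  by (intro integrable_sphere_measure continuous_intros continuous_on_Harm2 assms)

lemma integral_norm_sphere_measure:
  fixes h :: "'a::euclidean_space \<Rightarrow> real"
  assumes "continuous_on UNIV h"
  shows "integral\<^sup>L sphere_measure (\<lambda>y. (y \<bullet> y) * h y) = integral\<^sup>L sphere_measure h"
proof (rule integral_cong_AE)
  show "AE y in sphere_measure. (y \<bullet> y) * h y = h y"
    using AE_sphere_measure by eventually_elim (simp add: norm_eq_1)
qed (intro borel_measurable_integrable integrable_sphere_measure continuous_intros assms)+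

text \<open>On the unit sphere this is \<open>D g\<^sub>2(x \<bullet> y)\<close> in the notation of the paper. The factor
  \<open>x \<bullet> x\<close> makes the kernel symmetric, so that it reproduces at every point of the space.\<close>
definition zonal :: "real^'n \<Rightarrow> real^'n \<Rightarrow> real" where
  "zonal x y = (real CARD('n) + 2) / 2 * (real CARD('n) * (x \<bullet> y)^2 - (x \<bullet> x) * (y \<bullet> y))"

lemma zonal_in_Harm2: "zonal (x::real^'n) \<in> Harm2"
proof (rule Harm2I)
  let ?n = "real CARD('n)"
  \<comment> \<open>Up to the factor, this is the matrix of \<open>n\<close> times the
    projection-like form of \<open>x\<close> minus \<open>x \<bullet> x\<close> times the identity.
    Both parts have trace \<open>n * (x \<bullet> x)\<close>.\<close>
  let ?c = "\<lambda>i j. (?n + 2) / 2 * (?n * (x$i * x$j) - (x \<bullet> x) * (if i = j then 1 else 0))"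
  show "zonal x = (\<lambda>y. \<Sum>i\<in>UNIV. \<Sum>j\<in>UNIV. ?c i j * y$i * y$j)"
  proof
    fix y
    have "(x \<bullet> y)^2 = (\<Sum>i\<in>UNIV. \<Sum>j\<in>UNIV. (x$i * x$j) * y$i * y$j)"
      by (simp add: inner_vec_def power2_eq_square sum_product mult_ac)
    moreover have "y \<bullet> y = (\<Sum>i\<in>UNIV. \<Sum>j\<in>UNIV. (if i = j then 1 else 0) * y$i * y$j)"
      by (simp add: inner_vec_def mult_delta_left mult_delta_right)
    ultimately show "zonal x y = (\<Sum>i\<in>UNIV. \<Sum>j\<in>UNIV. ?c i j * y$i * y$j)"
      unfolding zonal_def
      by (simp add: sum_distrib_left right_diff_distrib left_diff_distrib sum_subtractf mult_ac)
  qed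
  have "(\<Sum>j\<in>UNIV. ?c j j) = (?n + 2) / 2 * (?n * (\<Sum>i\<in>UNIV. x$i * x$i) - ?n * (x \<bullet> x))"
    by (simp only: sum_distrib_left[symmetric] sum_subtractf) simp
  then show "(\<Sum>j\<in>UNIV. ?c j j) = 0"
    by (simp add: inner_vec_def)
qed

text \<open>Trace zero removes every contraction of \<open>Q\<close> with itself. Hence
  \<open>Q\<close> has mean zero, and its pairing with \<open>(x \<bullet> y)^2\<close> keeps only
  the two cross terms, each a multiple of \<open>Q x\<close>. The prefactor of \<open>zonal\<close>
  is chosen to cancel the remaining constant.\<close>

lemma harm_inner_zonal:
  fixes x :: "real^'n"
  assumes "Q \<in> Harm2"
  shows "harm_inner (zonal x) Q = Q x"
proof -
  obtain c where Q: "Q = (\<lambda>x. \<Sum>i\<in>UNIV. \<Sum>j\<in>UNIV. c i j * (x$i) * (x$j))"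
    and tr: "(\<Sum>j\<in>UNIV. c j j) = 0"
    using assms by (rule Harm2E)
  let ?n = "real CARD('n)"
  let ?e = "\<lambda>i. axis i 1 :: real^'n"
  note cont = continuous_on_Harm2[OF assms]
  \<comment> \<open>Coordinates become inner products with axis vectors so that the moment formulas
    apply.\<close>
  have ax: "y $ i = ?e i \<bullet> y" for y i
    by (simp add: inner_axis')
  have n: "?n > 0" "?n + 2 > 0"
    by simp_all
  have tr': "(\<Sum>i\<in>UNIV. \<Sum>j\<in>UNIV. c i j * (?e i \<bullet> ?e j) * a) = 0" for a
    using tr by (simp add: inner_axis_axis mult_delta_left mult_delta_right flip: sum_distrib_right)
  have 2: "integral\<^sup>L sphere_measure Q = 0"
  proof -
    have "integral\<^sup>L sphere_measure Q
        = (\<Sum>i\<in>UNIV. \<Sum>j\<in>UNIV. integral\<^sup>L sphere_measure (\<lambda>y. c i j * ((?e i \<bullet> y) * (?e j \<bullet> y))))"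
      unfolding Q ax by (subst Bochner_Integration.integral_sum
          | intro integrable_sphere_measure continuous_intros sum.cong refl | simp only: mult.assoc)+
    also have "\<dots> = (\<Sum>i\<in>UNIV. \<Sum>j\<in>UNIV. c i j * (?e i \<bullet> ?e j) * (1 / ?n))"
      by (simp only: integral_mult_right_zero quadratic_moment) simp
    finally show ?thesis
      by (simp only: tr')
  qed
  have 4: "integral\<^sup>L sphere_measure (\<lambda>y. (x \<bullet> y)^2 * Q y) = 2 / (?n * (?n + 2)) * Q x"
  proof -
    have "integral\<^sup>L sphere_measure (\<lambda>y. (x \<bullet> y)^2 * Q y)
        = integral\<^sup>L sphere_measure (\<lambda>y. \<Sum>i\<in>UNIV. \<Sum>j\<in>UNIV.
             c i j * ((x \<bullet> y) * (x \<bullet> y) * (?e i \<bullet> y) * (?e j \<bullet> y)))"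
      unfolding Q ax by (simp add: sum_distrib_left power2_eq_square mult_ac)
    also have "\<dots> = (\<Sum>i\<in>UNIV. \<Sum>j\<in>UNIV. integral\<^sup>L sphere_measure (\<lambda>y.
             c i j * ((x \<bullet> y) * (x \<bullet> y) * (?e i \<bullet> y) * (?e j \<bullet> y))))"
      by (subst Bochner_Integration.integral_sum
          | intro integrable_sphere_measure continuous_intros sum.cong refl)+
    also have "\<dots> = (\<Sum>i\<in>UNIV. \<Sum>j\<in>UNIV. c i j * (?e i \<bullet> ?e j) * ((x \<bullet> x) / (?n * (?n + 2)))
        + 2 / (?n * (?n + 2)) * (c i j * (?e i \<bullet> x) * (?e j \<bullet> x)))"
      by (simp only: integral_mult_right_zero quartic_moment)
        (intro sum.cong refl, simp add: inner_commute add_divide_distrib distrib_left mult_ac)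
    also have "\<dots> = 2 / (?n * (?n + 2)) * Q x"
      unfolding sum.distrib tr' unfolding Q ax by (simp add: sum_distrib_left)
    finally show ?thesis .
  qed
  have "harm_inner (zonal x) Q = integral\<^sup>L sphere_measure (\<lambda>y. (?n + 2) / 2 *
      (?n * ((x \<bullet> y)^2 * Q y) - (x \<bullet> x) * ((y \<bullet> y) * Q y)))"
    unfolding harm_inner_def zonal_def by (simp add: algebra_simps)
  also have "\<dots> = (?n + 2) / 2 * (?n * integral\<^sup>L sphere_measure (\<lambda>y. (x \<bullet> y)^2 * Q y)
      - (x \<bullet> x) * integral\<^sup>L sphere_measure (\<lambda>y. (y \<bullet> y) * Q y))"
    by (subst integral_mult_right_zero, subst Bochner_Integration.integral_diff)
      (auto intro!: integrable_sphere_measure continuous_intros cont)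
  also have "\<dots> = Q x"
    unfolding 4 integral_norm_sphere_measure[OF cont] 2 using n by simp
  finally show ?thesis .
qed

text \<open>Uniqueness follows by pairing a candidate \<open>K\<close> with \<open>zonal y\<close>:
  one reproducing property gives \<open>K y\<close>, the other gives \<open>zonal y x\<close>, and
  \<open>zonal\<close> is symmetric.\<close>

lemma reproducing_kernel_eq_zonal: "reproducing_kernel x = zonal x"
  unfolding reproducing_kernel_def
proof (rule the_equality)
  show "zonal x \<in> Harm2 \<and> (\<forall>Q\<in>Harm2. harm_inner (zonal x) Q = Q x)"
    by (simp add: zonal_in_Harm2 harm_inner_zonal)
next
  fix K assume K: "K \<in> Harm2 \<and> (\<forall>Q\<in>Harm2. harm_inner K Q = Q x)"
  show "K = zonal x"
  proof
    fix y
    have "K y = harm_inner (zonal y) K"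
      using K by (simp add: harm_inner_zonal)
    also have "\<dots> = harm_inner K (zonal y)"
      by (simp add: harm_inner_def mult.commute)
    also have "\<dots> = zonal x y"
      using K by (simp add: zonal_in_Harm2) (simp add: zonal_def inner_commute mult.commute)
    finally show "K y = zonal x y" .
  qed
qed

text \<open>By the reproducing property this is the squared norm of the kernel element; its value is
  the dimension \<open>D\<close>.\<close>

lemma zonal_self:
  fixes x :: "real^'n"
  assumes "norm x = 1"
  shows "zonal x x = (real CARD('n) - 1) * (real CARD('n) + 2) / 2"
  using assms by (simp add: zonal_def norm_eq_1)

section \<open>Normalized kernel elements in an orthonormal basis\<close>

lemma harm_inner_Gfun:
  fixes x :: "real^'n"
  assumes "Q \<in> Harm2"
  shows "harm_inner (Gfun x) Q = Q x / sqrt (zonal x x)"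
proof -
  have "harm_inner (Gfun x) Q = harm_inner (zonal x) Q / sqrt (zonal x x)"
    by (simp add: Gfun_def reproducing_kernel_eq_zonal Let_def harm_inner_zonal zonal_in_Harm2)
      (simp add: harm_inner_def)
  then show ?thesis
    by (simp add: harm_inner_zonal assms)
qed

text \<open>This is the addition formula: pairing the expansion of \<open>zonal x\<close> with
  \<open>b l\<close> and reproducing shows that its coefficients are the values
  \<open>b l x\<close>.\<close>

lemma orthonormal_basis_zonal:
  fixes b :: "'m::finite \<Rightarrow> (real^'n \<Rightarrow> real)"
  assumes b: "\<forall>k. b k \<in> Harm2"
    and orth: "\<forall>k l. harm_inner (b k) (b l) = (if k = l then 1 else 0)"
    and span: "\<forall>P\<in>Harm2. \<exists>c. P = (\<lambda>y. \<Sum>k\<in>UNIV. c k * b k y)"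
  shows "(\<Sum>k\<in>UNIV. b k x * b k y) = zonal x y"
proof -
  obtain c where c: "zonal x = (\<lambda>y. \<Sum>k\<in>UNIV. c k * b k y)"
    using span zonal_in_Harm2 by blast
  have "b l x = c l" for l
  proof -
    have "b l x = harm_inner (zonal x) (b l)"
      using b by (simp add: harm_inner_zonal)
    also have "\<dots> = integral\<^sup>L sphere_measure (\<lambda>y. \<Sum>k\<in>UNIV. c k * (b k y * b l y))"
      by (simp add: harm_inner_def c sum_distrib_left sum_distrib_right mult_ac)
    also have "\<dots> = (\<Sum>k\<in>UNIV. c k * harm_inner (b k) (b l))"
      using b by (subst Bochner_Integration.integral_sum) (auto simp: harm_inner_def integrable_harm_prod)
    finally show ?thesis
      by (simp add: orth mult_delta_right)
  qed
  then show ?thesis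
    by (simp add: c)
qed

section \<open>Frame potential and designs\<close>

text \<open>The second moment matrix \<open>M\<close> has trace \<open>1\<close>, so the hypothesis \<open>tr (M\<^sup>2) = 1 / m\<close>
  makes the squared Frobenius norm of \<open>M - I / m\<close> vanish.\<close>
lemma frame_potential_minimizer:
  fixes g :: "'a \<Rightarrow> real^'m"
  assumes X: "finite X" "X \<noteq> {}" and unit: "\<And>x. x \<in> X \<Longrightarrow> norm (g x) = 1"
    and pot: "(\<Sum>x\<in>X. \<Sum>y\<in>X. (g x \<bullet> g y)^2) / (real (card X))^2 = 1 / real CARD('m)"
  shows "(\<Sum>x\<in>X. g x $ k * g x $ l) / real (card X) = (if k = l then 1 / real CARD('m) else 0)"
proof -
  let ?N = "real (card X)" and ?m = "real CARD('m)"
  define M where "M i j = (\<Sum>x\<in>X. g x $ i * g x $ j) / ?N" for i j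
  let ?d = "\<lambda>i j. if i = j then 1 / ?m else 0"
  have N: "?N \<noteq> 0"
    using X by simp
  have "(\<Sum>i\<in>UNIV. M i i) = (\<Sum>x\<in>X. g x \<bullet> g x) / ?N"
    unfolding M_def inner_vec_def by (simp add: sum.swap[of _ X] flip: sum_divide_distrib)
  also have "\<dots> = 1"
    using N unit by (simp add: norm_eq_1)
  finally have tr: "(\<Sum>i\<in>UNIV. M i i) = 1" .
  have "(\<Sum>i\<in>UNIV. \<Sum>j\<in>UNIV. (M i j)^2)
      = (\<Sum>i\<in>UNIV. \<Sum>j\<in>UNIV. \<Sum>x\<in>X. \<Sum>y\<in>X. (g x $ i * g y $ i) * (g x $ j * g y $ j)) / ?N^2"
    by (simp add: M_def power_divide power2_eq_square sum_product mult_ac flip: sum_divide_distrib)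
  \<comment> \<open>Exchanging the sums turns the squared Frobenius norm of the moment matrix into
    the frame potential.\<close>
  also have "(\<Sum>i\<in>UNIV. \<Sum>j\<in>UNIV. \<Sum>x\<in>X. \<Sum>y\<in>X. (g x $ i * g y $ i) * (g x $ j * g y $ j))
      = (\<Sum>x\<in>X. \<Sum>y\<in>X. (g x \<bullet> g y)^2)"
    by (simp add: inner_vec_def power2_eq_square sum_product sum.swap[of _ X UNIV])
  finally have tr2: "(\<Sum>i\<in>UNIV. \<Sum>j\<in>UNIV. (M i j)^2) = 1 / ?m"
    using pot by simp
  have "(M i j - ?d i j)^2 = (M i j)^2 - (if i = j then 2 / ?m * M i j - 1 / ?m^2 else 0)" for i j
    by (simp add: power2_diff power_divide)
  then have "(\<Sum>i\<in>UNIV. \<Sum>j\<in>UNIV. (M i j - ?d i j)^2)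
      = 1 / ?m - (\<Sum>i\<in>UNIV. 2 / ?m * M i i - 1 / ?m^2)"
    by (simp add: sum_subtractf tr2)
  also have "\<dots> = 1 / ?m - (2 / ?m * (\<Sum>i\<in>UNIV. M i i) - ?m * (1 / ?m^2))"
    by (simp only: sum_subtractf sum_distrib_left) simp
  \<comment> \<open>With trace 1 the terms are 1/m - 2/m + 1/m.\<close>
  also have "\<dots> = 0"
    unfolding tr by (simp add: power2_eq_square)
  finally have "(\<Sum>i\<in>UNIV. \<Sum>j\<in>UNIV. (M i j - ?d i j)^2) = 0" .
  then have "(M k l - ?d k l)^2 = 0"
    by (simp add: sum_nonneg_eq_0_iff sum_nonneg)
  then show ?thesis
    by (simp add: M_def)
qed

text \<open>Splits one linear factor off a monomial; two applications write a monomial of degree two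
  as a product of two coordinates. The inner quantifier over \<open>f\<close> makes the choice
  independent of the evaluation point.\<close>

lemma prod_power_pick:
  fixes \<alpha> :: "'a \<Rightarrow> nat"
  assumes B: "finite B" and pos: "(\<Sum>b\<in>B. \<alpha> b) = Suc n"
  shows "\<exists>b\<in>B. \<exists>\<beta>. (\<Sum>b\<in>B. \<beta> b) = n \<and>
    (\<forall>f::'a \<Rightarrow> real. (\<Prod>b\<in>B. f b ^ \<alpha> b) = f b * (\<Prod>b\<in>B. f b ^ \<beta> b))"
proof -
  obtain b where b: "b \<in> B" "\<alpha> b > 0"
    using pos by (metis Zero_not_Suc gr0I sum.neutral)
  then obtain k where k: "\<alpha> b = Suc k"
    using gr0_implies_Suc by blast
  let ?\<beta> = "\<alpha>(b := k)"
  have "(\<Sum>b\<in>B. ?\<beta> b) = n"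
    using pos k by (simp add: sum.remove[OF B b(1)])
  moreover have "(\<Prod>b\<in>B. f b ^ \<alpha> b) = f b * (\<Prod>b\<in>B. f b ^ ?\<beta> b)" for f :: "'a \<Rightarrow> real"
    using k by (simp add: prod.remove[OF B b(1)])
  ultimately have "(\<Sum>b\<in>B. ?\<beta> b) = n \<and>
    (\<forall>f::'a \<Rightarrow> real. (\<Prod>b\<in>B. f b ^ \<alpha> b) = f b * (\<Prod>b\<in>B. f b ^ ?\<beta> b))"
    by simp
  then show ?thesis
    using b(1) by (intro bexI[of _ b] exI[of _ ?\<beta>])
qed

section \<open>Antipodal symmetry and the design condition up to degree three\<close>

lemma monomial_minus:
  fixes x :: "'a::euclidean_space"
  shows "(\<Prod>b\<in>Basis. (- x \<bullet> b) ^ \<alpha> b) = (- 1) ^ (\<Sum>b\<in>Basis. \<alpha> b) * (\<Prod>b\<in>Basis. (x \<bullet> b) ^ \<alpha> b)"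
proof -
  have "(- x \<bullet> b) ^ \<alpha> b = (- 1) ^ \<alpha> b * (x \<bullet> b) ^ \<alpha> b" for b
    by (metis inner_minus_left power_minus)
  then show ?thesis
    by (simp add: prod.distrib power_sum)
qed

lemma integral_sphere_measure_minus:
  fixes h :: "'a::euclidean_space \<Rightarrow> real"
  assumes "continuous_on UNIV h"
  shows "integral\<^sup>L sphere_measure (\<lambda>x. h (- x)) = integral\<^sup>L sphere_measure h"
proof (rule integral_sphere_measure_orthogonal)
  show "orthogonal_transformation (uminus :: 'a \<Rightarrow> 'a)"
    by (simp add: orthogonal_transformation_def linear_iff)
qed (rule borel_measurable_continuous_onI[OF assms])

text \<open>In odd degree both sides vanish by symmetry under negation. The remaining degrees are 0,
  which is normalization, and 2, where \<open>mom\<close> is exactly the second moment of the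
  surface measure.\<close>

lemma antipodal_monomial_average:
  fixes g :: "'a \<Rightarrow> real^'m"
  assumes X: "finite X" "X \<noteq> {}"
    and mom: "\<And>k l. (\<Sum>x\<in>X. g x $ k * g x $ l) / real (card X) = (if k = l then 1 / real CARD('m) else 0)"
    and deg: "(\<Sum>b\<in>Basis. \<alpha> b) \<le> 3"
  defines "p \<equiv> \<lambda>y::real^'m. \<Prod>b\<in>Basis. (y \<bullet> b) ^ \<alpha> b"
  shows "(\<Sum>x\<in>X. p (g x) + p (- g x)) / (2 * real (card X)) = integral\<^sup>L sphere_measure p"
proof -
  have N: "real (card X) \<noteq> 0"
    using X by simp
  have cont: "continuous_on UNIV p"
    unfolding p_def by (intro continuous_intros)
  have minus: "p (- y) = (- 1) ^ (\<Sum>b\<in>Basis. \<alpha> b) * p y" for y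
    unfolding p_def by (rule monomial_minus)
  show ?thesis
  proof (cases "odd (\<Sum>b\<in>Basis. \<alpha> b)")
    case True
    then have neg: "p (- y) = - p y" for y
      using minus by simp
    then have "integral\<^sup>L sphere_measure p = 0"
      using integral_sphere_measure_minus[OF cont] by simp
    then show ?thesis
      by (simp add: neg)
  next
    case False
    then have even: "p (- y) = p y" for y
      using minus by simp
    have eq: "(\<Sum>x\<in>X. p (g x) + p (- g x)) / (2 * real (card X)) = (\<Sum>x\<in>X. p (g x)) / real (card X)"
      by (simp only: even mult_2[symmetric] sum_distrib_left[symmetric])
    have small: "s = 0 \<or> s = Suc (Suc 0)" if "\<not> odd s" "s \<le> 3" for s :: nat
      using that by presburger
    consider "(\<Sum>b\<in>Basis. \<alpha> b) = 0" | "(\<Sum>b\<in>Basis. \<alpha> b) = Suc (Suc 0)"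
      using small[OF False deg] by auto
    then show ?thesis
    proof cases
      case 1
      then have "p = (\<lambda>y. 1)"
        by (simp add: p_def)
      then show ?thesis
        unfolding eq using N by (simp add: integral_sphere_measure_const)
    next
      case 2
      obtain u \<beta> where u: "u \<in> Basis" "(\<Sum>b\<in>Basis. \<beta> b) = Suc 0"
        "\<forall>f::real^'m \<Rightarrow> real. (\<Prod>b\<in>Basis. f b ^ \<alpha> b) = f u * (\<Prod>b\<in>Basis. f b ^ \<beta> b)"
        using prod_power_pick[OF finite_Basis 2] by (elim bexE exE conjE)
      obtain v \<gamma> where v: "v \<in> Basis" "(\<Sum>b\<in>Basis. \<gamma> b) = 0"
        "\<forall>f::real^'m \<Rightarrow> real. (\<Prod>b\<in>Basis. f b ^ \<beta> b) = f v * (\<Prod>b\<in>Basis. f b ^ \<gamma> b)"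
        using prod_power_pick[OF finite_Basis u(2)] by (elim bexE exE conjE)
      have p: "p = (\<lambda>y. (u \<bullet> y) * (v \<bullet> y))"
        unfolding p_def u(3)[rule_format] v(3)[rule_format] using v(2) by (simp add: inner_commute)
      obtain k l where "u = axis k 1" "v = axis l 1"
        using u(1) v(1) by (auto simp: Basis_vec_def)
      then show ?thesis
        unfolding eq unfolding p quadratic_moment
        using mom[of k l] by (simp add: inner_axis' inner_axis_axis) (simp add: axis_def)
    qed
  qed
qed

text \<open>Both the average over the points and the integral are linear, so the monomial case
  suffices.\<close>

lemma spherical_design_3_antipodal:
  fixes g :: "'a \<Rightarrow> real^'m"
  assumes X: "finite X" "X \<noteq> {}" and unit: "\<And>x. x \<in> X \<Longrightarrow> norm (g x) = 1"
    and mom: "\<And>k l. (\<Sum>x\<in>X. g x $ k * g x $ l) / real (card X) = (if k = l then 1 / real CARD('m) else 0)"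
  shows "spherical_design 3 (image_mset g (mset_set X) + image_mset (\<lambda>x. - g x) (mset_set X))"
    (is "spherical_design 3 ?Y")
proof -
  have size: "real (size ?Y) = 2 * real (card X)"
    by simp
  have "(\<Sum>y\<in>#?Y. f y) / real (size ?Y) = integral\<^sup>L sphere_measure f"
    if poly: "f \<in> poly_deg_le 3" for f
  proof -
    obtain A :: "(real^'m \<Rightarrow> nat) set" and c where A: "finite A" "\<forall>\<alpha>\<in>A. (\<Sum>b\<in>Basis. \<alpha> b) \<le> 3"
      and f: "f = (\<lambda>x. \<Sum>\<alpha>\<in>A. c \<alpha> * (\<Prod>b\<in>Basis. (x \<bullet> b) ^ \<alpha> b))"
      using poly unfolding poly_deg_le_def mem_Collect_eq by (elim exE conjE)
    let ?p = "\<lambda>\<alpha> (y::real^'m). \<Prod>b\<in>Basis. (y \<bullet> b) ^ \<alpha> b"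
    have "(\<Sum>y\<in>#?Y. f y) = (\<Sum>x\<in>X. f (g x) + f (- g x))"
      by (simp add: image_mset.compositionality comp_def sum_unfold_sum_mset sum_mset.distrib)
    also have "\<dots> = (\<Sum>\<alpha>\<in>A. c \<alpha> * (\<Sum>x\<in>X. ?p \<alpha> (g x) + ?p \<alpha> (- g x)))"
      unfolding f sum.distrib[symmetric] distrib_left[symmetric] sum_distrib_left by (rule sum.swap)
    finally have "(\<Sum>y\<in>#?Y. f y) / real (size ?Y)
        = (\<Sum>\<alpha>\<in>A. c \<alpha> * ((\<Sum>x\<in>X. ?p \<alpha> (g x) + ?p \<alpha> (- g x)) / (2 * real (card X))))"
      unfolding size by (simp only: sum_divide_distrib[where A=A] times_divide_eq_right)
    also have "\<dots> = (\<Sum>\<alpha>\<in>A. c \<alpha> * integral\<^sup>L sphere_measure (?p \<alpha>))"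
      using antipodal_monomial_average[OF X mom] A(2) by (intro sum.cong refl) auto
    also have "\<dots> = integral\<^sup>L sphere_measure f"
      unfolding f by (subst Bochner_Integration.integral_sum)
        (auto intro!: integrable_sphere_measure continuous_intros)
    finally show ?thesis .
  qed
  moreover have "?Y \<noteq> {#}"
    using X by (simp add: mset_set_empty_iff)
  ultimately show ?thesis
    using X unit unfolding spherical_design_def by auto
qed

text \<open>The basis \<open>b\<close> realizes the identification of \<open>Harm2\<close> with
  \<open>real^'m\<close>. Taking images of \<open>mset_set X\<close> keeps multiplicities, which
  matters because \<open>x\<close> and \<open>- x\<close> have the same \<open>Gfun\<close>.\<close>

theorem theorem1p2:
  fixes X :: "(real^'n) set" and b :: "'m::finite \<Rightarrow> (real^'n \<Rightarrow> real)"
  assumes "CARD('n) \<ge> 2"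
    and "finite X" and "X \<noteq> {}" and "\<forall>x\<in>X. norm x = 1"
    and "(\<Sum>x\<in>X. \<Sum>y\<in>X. (x \<bullet> y) ^ 2) / (real (card X))^2 = 1 / real CARD('n)"
    and "(\<Sum>x\<in>X. \<Sum>y\<in>X. (x \<bullet> y) ^ 4) / (real (card X))^2
           = 3 / ((real CARD('n) + 2) * real CARD('n))"
    and "CARD('m) = (CARD('n) - 1) * (CARD('n) + 2) div 2"
    and "\<forall>k. b k \<in> Harm2"
    and "\<forall>k l. harm_inner (b k) (b l) = (if k = l then 1 else 0)"
    and "\<forall>P\<in>Harm2. \<exists>c. P = (\<lambda>y. \<Sum>k\<in>UNIV. c k * b k y)"
  shows "spherical_design 3
           (image_mset (\<lambda>x. \<chi> k. harm_inner (Gfun x) (b k)) (mset_set X)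
            + image_mset (\<lambda>x. - (\<chi> k. harm_inner (Gfun x) (b k))) (mset_set X))"
proof -
  let ?n = "real CARD('n)" and ?N = "real (card X)"
  define g where "g x = (\<chi> k. harm_inner (Gfun x) (b k))" for x :: "real^'n"
  define D where "D = (?n - 1) * (?n + 2) / 2"
  note n = assms(1) and X = assms(2,3) and unit = assms(4) and sum2 = assms(5) and sum4 = assms(6)
    and dim = assms(7) and b = assms(8) and orth = assms(9) and span = assms(10)
  have n2: "?n \<ge> 2"
    using n by simp
  then have D: "D > 0"
    by (simp add: D_def)
  have N: "?N \<noteq> 0"
    using X by simp
  \<comment> \<open>The two factors differ by 3, so one of them is even and the division in
    \<open>dim\<close> is exact.\<close>
  have "even ((CARD('n) - 1) * (CARD('n) + 2))"
    using n by auto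
  then have m: "real CARD('m) = D"
    unfolding dim D_def using n by (simp add: real_of_nat_div algebra_simps)
  \<comment> \<open>With \<open>n = d + 1\<close> the right side is the polynomial
    \<open>g_{2,d}\<close> evaluated at \<open>x \<bullet> y\<close>.\<close>
  have inner_g: "g x \<bullet> g y = (?n * (x \<bullet> y)^2 - 1) / (?n - 1)" if "x \<in> X" "y \<in> X" for x y
  proof -
    have xy: "norm x = 1" "norm y = 1"
      using that unit by auto
    have "g x \<bullet> g y = (\<Sum>k\<in>UNIV. b k x * b k y) / D"
      using b D by (simp add: g_def inner_vec_def harm_inner_Gfun zonal_self[OF xy(1)] zonal_self[OF xy(2)]
          flip: D_def sum_divide_distrib)
    also have "\<dots> = zonal x y / D"
      by (simp add: orthonormal_basis_zonal[OF b orth span])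
    also have "\<dots> = (?n * (x \<bullet> y)^2 - 1) / (?n - 1)"
      using xy n2 by (simp add: zonal_def D_def norm_eq_1 divide_simps)
    finally show ?thesis .
  qed
  have "norm (g x) = 1" if "x \<in> X" for x
    using inner_g[OF that that] that unit n2 by (simp add: norm_eq_1)
  moreover have "(\<Sum>x\<in>X. \<Sum>y\<in>X. (g x \<bullet> g y)^2) / ?N^2 = 1 / real CARD('m)"
  proof -
    have "(\<Sum>x\<in>X. \<Sum>y\<in>X. (g x \<bullet> g y)^2)
        = (\<Sum>x\<in>X. \<Sum>y\<in>X. (?n^2 * (x \<bullet> y)^4 - 2 * ?n * (x \<bullet> y)^2 + 1) / (?n - 1)^2)"
      by (intro sum.cong refl) (simp add: inner_g power_divide power2_diff power_mult_distrib)
    also have "\<dots> = (?n^2 * (\<Sum>x\<in>X. \<Sum>y\<in>X. (x \<bullet> y)^4) - 2 * ?n * (\<Sum>x\<in>X. \<Sum>y\<in>X. (x \<bullet> y)^2) + ?N^2)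
        / (?n - 1)^2"
      by (simp add: sum.distrib sum_subtractf power2_eq_square flip: sum_divide_distrib sum_distrib_left)
    finally have "(\<Sum>x\<in>X. \<Sum>y\<in>X. (g x \<bullet> g y)^2) / ?N^2
        = (?n^2 * ((\<Sum>x\<in>X. \<Sum>y\<in>X. (x \<bullet> y)^4) / ?N^2)
           - 2 * ?n * ((\<Sum>x\<in>X. \<Sum>y\<in>X. (x \<bullet> y)^2) / ?N^2) + 1) / (?n - 1)^2"
      using N by (simp add: add_divide_distrib diff_divide_distrib mult.commute)
    also have "\<dots> = 1 / D"
    proof -
      \<comment> \<open>The numerator is 3a/(a+2) - 1 = 2(a-1)/(a+2), and dividing by the square of
        a-1 leaves the reciprocal of the dimension.\<close>
      have "(a^2 * (3 / ((a + 2) * a)) - 2 * a * (1 / a) + 1) / (a - 1)^2 = 1 / ((a - 1) * (a + 2) / 2)"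
        if "a \<ge> 2" for a :: real
      proof -
        have "a \<noteq> 0" "a + 2 \<noteq> 0" "a - 1 \<noteq> 0"
          using that by auto
        then have eq: "a^2 * (3 / ((a + 2) * a)) - 2 * a * (1 / a) + 1 = 2 * (a - 1) / (a + 2)"
          by (simp add: divide_simps power2_eq_square)
        show ?thesis
          unfolding eq using \<open>a - 1 \<noteq> 0\<close> \<open>a + 2 \<noteq> 0\<close>
          by (simp add: divide_simps power2_eq_square)
      qed
      then show ?thesis
        unfolding sum2 sum4 D_def using n2 by blast
    qed
    finally show ?thesis
      unfolding m .
  qed
  ultimately have "spherical_design 3 (image_mset g (mset_set X) + image_mset (\<lambda>x. - g x) (mset_set X))"
    by (intro spherical_design_3_antipodal frame_potential_minimizer X)
  then show ?thesis
    by (simp only: g_def[abs_def])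
qed

end
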